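(* Let $D\ge3$ and $r\ge1$ be integers, and consider a system consisting of $r$ quadratic forms and a single form of degree $D$, that is, $r_2=r$, $r_D=1$ and $r_d=0$ for all other $d\le D$. Then $$n_0=\begin{cases}(2+r)(D-1)2^{D-1}+2r(r+1) & \text{if } r>(D-1)2^{D-2},\\ (2+2r)(D-1)2^{D-1}+4r & \text{otherwise.}\end{cases}$$
   Context: For non-negative integers $r_1,\dots,r_D$ with $r_D\ge1$ (where $r_d$ is the number of forms of degree $d$ in a system) put $\Delta=\{d:r_d\ge1\}$, $\mathcal{D}_j=r_1+2r_2+\dots+jr_j$ for $1\le j\le D$, $\mathcal{D}_0=0$, and $$t_d=\sum_{k=d}^D2^{k-1}(k-1)r_k\quad(1\le d\le D+1),\qquad n_0(d)=\mathcal{D}_d\left(2^{d-1}+t_{d+1}\right)+t_{d+1}+\sum_{j=d+1}^Dt_jr_j,$$ $$n_0=\max\{n_0(d):d\in\Delta\cup\{0\}\},$$ with empty sums equal to $0$. *)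

theory Defs
  imports Main
begin

text \<open>
  A system of forms enters only through its largest degree \<open>D\<close> and the function \<open>r\<close>, where \<open>r d\<close>
  is the number of forms of degree \<open>d\<close>. Only the values \<open>r d\<close> with \<open>1 \<le> d \<le> D\<close> are used.
\<close>

definition degrees :: "nat \<Rightarrow> (nat \<Rightarrow> nat) \<Rightarrow> nat set" where
  "degrees D r = {d \<in> {1..D}. r d \<ge> 1}"

definition total_degree :: "(nat \<Rightarrow> nat) \<Rightarrow> nat \<Rightarrow> nat" where
  "total_degree r j = (\<Sum>i=1..j. i * r i)"

text \<open>Meaningful for \<open>1 \<le> d \<le> D + 1\<close>; the subtractions are then exact.\<close>

definition t_sum :: "nat \<Rightarrow> (nat \<Rightarrow> nat) \<Rightarrow> nat \<Rightarrow> nat" where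
  "t_sum D r d = (\<Sum>k=d..D. 2 ^ (k - 1) * (k - 1) * r k)"

text \<open>
  For \<open>d = 0\<close> the exponent \<open>d - 1\<close> is truncated to \<open>0\<close> instead of being \<open>-1\<close>. This is harmless,
  since the factor \<open>total_degree r 0\<close> is \<open>0\<close>.
\<close>

definition n0_at :: "nat \<Rightarrow> (nat \<Rightarrow> nat) \<Rightarrow> nat \<Rightarrow> nat" where
  "n0_at D r d = total_degree r d * (2 ^ (d - 1) + t_sum D r (d + 1))
     + t_sum D r (d + 1) + (\<Sum>j=d+1..D. t_sum D r j * r j)"

definition n0 :: "nat \<Rightarrow> (nat \<Rightarrow> nat) \<Rightarrow> nat" where
  "n0 D r = Max {n0_at D r d | d. d \<in> degrees D r \<union> {0}}"

end

theory Submission imports Defs begin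

text \<open>
  Put \<open>T = (D - 1) * 2 ^ (D - 1)\<close>, the contribution of the single form of degree \<open>D\<close> to
  \<open>t_sum\<close>. Only the degrees \<open>2\<close> and \<open>D\<close> contribute to any of the sums, so the maximum is over
  \<open>d = 0, 2, D\<close>, where \<open>n0_at\<close> takes the values
  \<open>(2 + r) * T + 2 * r * (r + 1)\<close>, \<open>(2 + 2 * r) * T + 4 * r\<close> and \<open>(2 * r + D) * 2 ^ (D - 1)\<close>.
  The last is dominated by the second since \<open>2 * r + D \<le> (2 + 2 * r) * (D - 1)\<close>. The first minus the
  second is \<open>r * (2 * r - 2 - T)\<close>, which is non-negative exactly if \<open>r \<ge> T / 2 + 1\<close>, that is,
  \<open>r > (D - 1) * 2 ^ (D - 2)\<close>; at \<open>r = T / 2 + 1\<close> the two values agree.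
\<close>

text \<open>
  With a suitable weight \<open>g\<close> this evaluates each of \<open>total_degree\<close>, \<open>t_sum\<close> and the last sum in
  \<open>n0_at\<close>. If \<open>D\<close> were \<open>2\<close>, the two summands on the right would count one index twice.
\<close>

lemma sum_two_degrees:
  fixes D r a b :: nat and rs g :: "nat \<Rightarrow> nat"
  assumes "D \<noteq> 2" and "rs 2 = r" and "rs D = 1"
    and "\<And>d. 1 \<le> d \<Longrightarrow> d \<le> D \<Longrightarrow> d \<noteq> 2 \<Longrightarrow> d \<noteq> D \<Longrightarrow> rs d = 0"
    and "1 \<le> a" and "b \<le> D"
  shows "(\<Sum>k=a..b. g k * rs k) =
    (if 2 \<in> {a..b} then g 2 * r else 0) + (if D \<in> {a..b} then g D else 0)"
proof -
  have "(\<Sum>k=a..b. g k * rs k) =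
      (\<Sum>k=a..b. (if k = 2 then g 2 * r else 0) + (if k = D then g D else 0))"
    using assms by (intro sum.cong refl) (auto split: if_splits)
  also have "\<dots> = (if 2 \<in> {a..b} then g 2 * r else 0) + (if D \<in> {a..b} then g D else 0)"
    by (simp add: sum.distrib)
  finally show ?thesis .
qed

theorem corollary1p4:
  fixes D r :: nat and rs :: "nat \<Rightarrow> nat"
  assumes "D \<ge> 3" and "r \<ge> 1"
    and "rs 2 = r" and "rs D = 1"
    and "\<And>d. 1 \<le> d \<Longrightarrow> d \<le> D \<Longrightarrow> d \<noteq> 2 \<Longrightarrow> d \<noteq> D \<Longrightarrow> rs d = 0"
  shows "n0 D rs =
    (if r > (D - 1) * 2 ^ (D - 2)
     then (2 + r) * (D - 1) * 2 ^ (D - 1) + 2 * r * (r + 1)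
     else (2 + 2 * r) * (D - 1) * 2 ^ (D - 1) + 4 * r)"
proof -
  have "D \<noteq> 2" using assms(1) by simp
  note collapse = sum_two_degrees[OF this assms(3-5)]
  define T where "T = (D - 1) * 2 ^ (D - 1)"
  define H where "H = (D - 1) * 2 ^ (D - 2)"
  have "D - 1 = Suc (D - 2)" using assms(1) by simp
  then have T_eq: "T = 2 * H" by (simp add: T_def H_def)

  have t: "t_sum D rs d = (if d \<le> 2 then 2 * r else 0) + (if d \<le> D then T else 0)"
    if "1 \<le> d" for d
    unfolding t_sum_def T_def using that assms(1)
      collapse[of d D "\<lambda>k. 2 ^ (k - 1) * (k - 1)"] by simp
  have total: "total_degree rs j = (if 2 \<le> j then 2 * r else 0) + (if j = D then D else 0)"
    if "j \<le> D" for j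
    unfolding total_degree_def using that assms(1) collapse[of 1 j "\<lambda>i. i"] by auto
  have tail: "(\<Sum>j=d+1..D. t_sum D rs j * rs j) =
      (if d < 2 then (2 * r + T) * r else 0) + (if d < D then T else 0)" for d
    using assms(1) collapse[of "d + 1" D "t_sum D rs"] by (simp add: t)

  have at_0: "n0_at D rs 0 = (2 + r) * T + 2 * r * (r + 1)"
    unfolding n0_at_def tail using assms(1) by (simp add: t total algebra_simps)
  have at_2: "n0_at D rs 2 = (2 + 2 * r) * T + 4 * r"
    unfolding n0_at_def tail using assms(1) by (simp add: t total algebra_simps)
  have at_D: "n0_at D rs D = (2 * r + D) * 2 ^ (D - 1)"
    unfolding n0_at_def tail using assms(1) by (simp add: t total)

  have "2 * r + D \<le> (2 + 2 * r) * (D - 1)"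
  proof -
    have "2 * r * 1 \<le> 2 * r * (D - 1)"
      using assms(1) by (intro mult_left_mono) auto
    moreover have "D \<le> 2 * (D - 1)" using assms(1) by simp
    ultimately show ?thesis unfolding distrib_right by linarith
  qed
  then have "(2 * r + D) * 2 ^ (D - 1) \<le> (2 + 2 * r) * (D - 1) * 2 ^ (D - 1)"
    by (rule mult_right_mono) simp
  also have "\<dots> = (2 + 2 * r) * T"
    unfolding T_def by (simp only: mult_ac)
  finally have D_le_2: "n0_at D rs D \<le> n0_at D rs 2"
    unfolding at_D at_2 by simp

  \<comment> \<open>As \<open>T = 2 * H\<close> is even, the strict bound \<open>r > H\<close> gives the missing summand: \<open>2 * r \<ge> T + 2\<close>.\<close>
  have two_le_0: "n0_at D rs 2 \<le> n0_at D rs 0" if "r > H"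
  proof -
    have "r * (T + 2) \<le> r * (2 * r)" using that T_eq by (intro mult_left_mono) auto
    then show ?thesis unfolding at_0 at_2 by (simp add: algebra_simps)
  qed
  have zero_le_2: "n0_at D rs 0 \<le> n0_at D rs 2" if "\<not> r > H"
  proof -
    have "r * (2 * r) \<le> r * (T + 2)" using that T_eq by (intro mult_left_mono) auto
    then show ?thesis unfolding at_0 at_2 by (simp add: algebra_simps)
  qed

  have degs: "degrees D rs = {2, D}"
    unfolding degrees_def using assms by fastforce
  have "{n0_at D rs d | d. d \<in> degrees D rs \<union> {0}} = {n0_at D rs 0, n0_at D rs 2, n0_at D rs D}"
    unfolding degs by auto
  then have "n0 D rs = max (n0_at D rs 0) (max (n0_at D rs 2) (n0_at D rs D))"
    unfolding n0_def by simp
  also have "\<dots> = (if r > H then n0_at D rs 0 else n0_at D rs 2)"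
    using D_le_2 two_le_0 zero_le_2 by (cases "r > H") (auto simp: max_def)
  finally show ?thesis
    unfolding at_0 at_2 T_def H_def by (simp only: mult.assoc)
qed

end
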